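(* Let $(X,\|\cdot\|)$ be a real normed space and let $g$ be a semi-inner product on $X$ (in the sense given in the context). Then the mapping $\|\cdot,\cdot\|_g$ on $X\times X$ defined by $$\|x_1,x_2\|_g=\sup_{y_1,y_2\in X,\ \|y_1\|\le 1,\ \|y_2\|\le 1}\det\begin{pmatrix} g(y_1,x_1) & g(y_2,x_1)\\ g(y_1,x_2) & g(y_2,x_2)\end{pmatrix}$$ is a $2$-norm on $X$.
   Context: For a real normed space $(X,\|\cdot\|)$ define $g:X^2\to\mathbb{R}$ by $g(x,y):=\frac12\|x\|\,[\tau_+(x,y)+\tau_-(x,y)]$, where $\tau_{\pm}(x,y):=\lim_{t\to\pm 0}\frac{\|x+ty\|-\|x\|}{t}$. This functional satisfies $g(x,x)=\|x\|^2$, $g(ax,by)=ab\,g(x,y)$, $g(x,x+y)=\|x\|^2+g(x,y)$ and $|g(x,y)|\le\|x\|\,\|y\|$ for all $x,y\in X$, $a,b\in\mathbb{R}$. If in addition $g(x,y)$ is linear in $y$, then $g$ is called a semi-inner product on $X$. A $2$-norm on a real vector space $X$ is a mapping $\|\cdot,\cdot\|:X\times X\to\mathbb{R}$ such that: (1) $\|x,y\|=0$ if and only if $x,y$ are linearly dependent; (2) $\|x,y\|=\|y,x\|$ for all $x,y\in X$; (3) $\|\alpha x,y\|=|\alpha|\,\|x,y\|$ for all $x,y\in X$ and $\alpha\in\mathbb{R}$; (4) $\|x,y+z\|\le\|x,y\|+\|x,z\|$ for all $x,y,z\in X$. *)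

theory Defs
  imports "HOL-Analysis.Analysis"
begin

text \<open>One-sided directional derivatives of the norm. Both limits always exist, since
  \<open>t \<mapsto> norm (x + t *\<^sub>R y)\<close> is convex and Lipschitz.\<close>

definition tau_plus :: "'a::real_normed_vector \<Rightarrow> 'a \<Rightarrow> real" where
  "tau_plus x y = Lim (at_right 0) (\<lambda>t::real. (norm (x + t *\<^sub>R y) - norm x) / t)"

definition tau_minus :: "'a::real_normed_vector \<Rightarrow> 'a \<Rightarrow> real" where
  "tau_minus x y = Lim (at_left 0) (\<lambda>t::real. (norm (x + t *\<^sub>R y) - norm x) / t)"

definition g_functional :: "'a::real_normed_vector \<Rightarrow> 'a \<Rightarrow> real" where
  "g_functional x y = 1/2 * norm x * (tau_plus x y + tau_minus x y)"

text \<open>The functional is determined by the norm; being a semi-inner product is the additional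
  requirement of linearity in the second argument.\<close>

definition semi_inner_product :: "('a::real_normed_vector \<Rightarrow> 'a \<Rightarrow> real) \<Rightarrow> bool" where
  "semi_inner_product g \<longleftrightarrow> g = g_functional \<and> (\<forall>x. linear (g x))"

text \<open>Linear dependence of the pair, as a family: the library's \<open>dependent {x, y}\<close> would
  wrongly regard \<open>x, x\<close> as independent for nonzero \<open>x\<close>.\<close>

definition lin_dependent_pair :: "'a::real_vector \<Rightarrow> 'a \<Rightarrow> bool" where
  "lin_dependent_pair x y \<longleftrightarrow>
     (\<exists>a b::real. (a \<noteq> 0 \<or> b \<noteq> 0) \<and> a *\<^sub>R x + b *\<^sub>R y = 0)"

definition two_norm :: "('a::real_vector \<Rightarrow> 'a \<Rightarrow> real) \<Rightarrow> bool" where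
  "two_norm N \<longleftrightarrow>
     (\<forall>x y. N x y = 0 \<longleftrightarrow> lin_dependent_pair x y) \<and>
     (\<forall>x y. N x y = N y x) \<and>
     (\<forall>x y \<alpha>. N (\<alpha> *\<^sub>R x) y = \<bar>\<alpha>\<bar> * N x y) \<and>
     (\<forall>x y z. N x (y + z) \<le> N x y + N x z)"

text \<open>The supremum is finite: \<open>\<bar>g y x\<bar> \<le> norm y * norm x\<close> bounds the determinants
  by \<open>2 * norm x1 * norm x2\<close>.\<close>

definition g_two_norm :: "('a::real_normed_vector \<Rightarrow> 'a \<Rightarrow> real) \<Rightarrow> 'a \<Rightarrow> 'a \<Rightarrow> real" where
  "g_two_norm g x1 x2 =
     (SUP (y1, y2) \<in> {(y1, y2). norm y1 \<le> 1 \<and> norm y2 \<le> 1}.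
        det (vector [vector [g y1 x1, g y2 x1],
                     vector [g y1 x2, g y2 x2]] :: real^2^2))"

end

theory Submission
  imports Defs
begin

text \<open>The supremum runs over the \<open>2 \<times> 2\<close> determinants
  \<open>D y\<^sub>1 y\<^sub>2 x\<^sub>1 x\<^sub>2 = g y\<^sub>1 x\<^sub>1 * g y\<^sub>2 x\<^sub>2 - g y\<^sub>2 x\<^sub>1 * g y\<^sub>1 x\<^sub>2\<close>, which are bilinear and alternating in
  \<open>(x\<^sub>1, x\<^sub>2)\<close>, because \<open>g\<close> is linear in its second argument, and antisymmetric in \<open>(y\<^sub>1, y\<^sub>2)\<close>.
  Since \<open>\<bar>g y x\<bar> \<le> \<parallel>y\<parallel> * \<parallel>x\<parallel>\<close>, they are bounded, so the supremum is finite. Interchanging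
  \<open>y\<^sub>1\<close> and \<open>y\<^sub>2\<close> changes the sign of \<open>D\<close>; the supremum is therefore also that of \<open>\<bar>D\<bar>\<close>, which
  gives symmetry, absolute homogeneity and vanishing on dependent pairs. Subadditivity is that of
  a supremum of linear functionals.

  For a linearly independent pair, a positive determinant comes from an orthogonalisation:
  with \<open>y\<^sub>1 = x\<^sub>1 / \<parallel>x\<^sub>1\<parallel>\<close>, subtract from \<open>x\<^sub>2\<close> the multiple of \<open>x\<^sub>1\<close> that leaves \<open>z \<noteq> 0\<close> with
  \<open>g y\<^sub>1 z = 0\<close>, and take \<open>y\<^sub>2 = z / \<parallel>z\<parallel>\<close>. The determinant is then \<open>\<parallel>x\<^sub>1\<parallel> * \<parallel>z\<parallel>\<close>, by
  \<open>g x x = \<parallel>x\<parallel>\<^sup>2\<close>.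

  The two properties of \<open>g\<close> used besides linearity are those of one-sided derivatives of the
  norm. The bound needs the limits to exist: by convexity the difference quotients
  are monotone, and by the triangle inequality they lie between \<open>- \<parallel>y\<parallel>\<close> and \<open>\<parallel>y\<parallel>\<close>.\<close>

section \<open>One-sided derivatives of the norm\<close>

lemma norm_diff_quotient_mono:
  fixes x y :: "'a::real_normed_vector"
  assumes "0 < s" "s \<le> t"
  shows "(norm (x + s *\<^sub>R y) - norm x) / s \<le> (norm (x + t *\<^sub>R y) - norm x) / t"
proof -
  have t: "0 < t" using assms by simp
  have "x + s *\<^sub>R y = (1 - s/t) *\<^sub>R x + (s/t) *\<^sub>R (x + t *\<^sub>R y)"
    using t by (simp add: algebra_simps)
  also have "norm \<dots> \<le> norm ((1 - s/t) *\<^sub>R x) + norm ((s/t) *\<^sub>R (x + t *\<^sub>R y))"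
    by (rule norm_triangle_ineq)
  also have "\<dots> = (1 - s/t) * norm x + (s/t) * norm (x + t *\<^sub>R y)"
    using assms t by simp
  finally have "norm (x + s *\<^sub>R y) - norm x \<le> s * ((norm (x + t *\<^sub>R y) - norm x) / t)"
    by (simp add: algebra_simps diff_divide_distrib)
  then show ?thesis
    using assms by (simp add: pos_divide_le_eq mult.commute)
qed

lemma abs_norm_diff_quotient_le:
  fixes x y :: "'a::real_normed_vector"
  assumes "t \<noteq> 0"
  shows "\<bar>(norm (x + t *\<^sub>R y) - norm x) / t\<bar> \<le> norm y"
proof -
  have "\<bar>norm (x + t *\<^sub>R y) - norm x\<bar> \<le> norm (t *\<^sub>R y)"
    using norm_triangle_ineq3[of "x + t *\<^sub>R y" x] by simp
  then show ?thesis
    using assms by (simp add: pos_divide_le_eq mult.commute)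
qed

lemma tau_plus_tendsto:
  fixes x y :: "'a::real_normed_vector"
  shows "((\<lambda>t. (norm (x + t *\<^sub>R y) - norm x) / t) \<longlongrightarrow> tau_plus x y) (at_right 0)"
proof -
  let ?q = "\<lambda>t::real. (norm (x + t *\<^sub>R y) - norm x) / t"
  have "(?q \<longlongrightarrow> Inf (?q ` ({0<..} \<inter> UNIV))) (at 0 within ({0<..} \<inter> UNIV))"
  proof (rule Lim_right_bound)
    show "?q a \<le> ?q b" if "a \<in> UNIV" "b \<in> UNIV" "0 < a" "a \<le> b" for a b
      using that by (intro norm_diff_quotient_mono)
    show "- norm y \<le> ?q a" if "a \<in> UNIV" "0 < a" for a
      using abs_norm_diff_quotient_le[of a x y] that by linarith
  qed
  then have "(?q \<longlongrightarrow> Inf (?q ` {0<..})) (at_right 0)"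
    by simp
  moreover from this have "tau_plus x y = Inf (?q ` {0<..})"
    unfolding tau_plus_def by (intro tendsto_Lim) auto
  ultimately show ?thesis by simp
qed

text \<open>The left limit reduces to the right limit in the opposite direction \<open>- y\<close>.\<close>

lemma tau_minus_tendsto:
  fixes x y :: "'a::real_normed_vector"
  shows "((\<lambda>t. (norm (x + t *\<^sub>R y) - norm x) / t) \<longlongrightarrow> tau_minus x y) (at_left 0)"
proof -
  let ?q = "\<lambda>t::real. (norm (x + t *\<^sub>R y) - norm x) / t"
  have "((\<lambda>t. - ((norm (x + t *\<^sub>R (- y)) - norm x) / t)) \<longlongrightarrow> - tau_plus x (- y)) (at_right 0)"
    by (intro tendsto_minus tau_plus_tendsto)
  then have lim: "(?q \<longlongrightarrow> - tau_plus x (- y)) (at_left 0)"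
    by (simp add: filterlim_at_left_to_right)
  then have "tau_minus x y = - tau_plus x (- y)"
    unfolding tau_minus_def by (intro tendsto_Lim) auto
  with lim show ?thesis by simp
qed

lemma abs_tau_plus_le: "\<bar>tau_plus x y\<bar> \<le> norm y"
proof (rule tendsto_upperbound[OF tendsto_rabs[OF tau_plus_tendsto]])
  show "\<forall>\<^sub>F t in at_right 0. \<bar>(norm (x + t *\<^sub>R y) - norm x) / t\<bar> \<le> norm y"
    using eventually_at_right_less[of 0]
    by eventually_elim (simp only: abs_norm_diff_quotient_le less_imp_neq[symmetric] not_False_eq_True)
qed simp

lemma abs_tau_minus_le: "\<bar>tau_minus x y\<bar> \<le> norm y"
proof (rule tendsto_upperbound[OF tendsto_rabs[OF tau_minus_tendsto]])
  show "\<forall>\<^sub>F t in at_left 0. \<bar>(norm (x + t *\<^sub>R y) - norm x) / t\<bar> \<le> norm y"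
    by (auto simp: eventually_at_filter abs_norm_diff_quotient_le simp del: abs_divide)
qed simp

lemma abs_g_functional_le: "\<bar>g_functional x y\<bar> \<le> norm x * norm y"
proof -
  have "\<bar>g_functional x y\<bar> = norm x * (\<bar>tau_plus x y + tau_minus x y\<bar> / 2)"
    by (simp add: g_functional_def abs_mult)
  also have "\<dots> \<le> norm x * norm y"
    using abs_tau_plus_le[of x y] abs_tau_minus_le[of x y] by (intro mult_left_mono) auto
  finally show ?thesis .
qed

lemma norm_diff_quotient_self:
  fixes x :: "'a::real_normed_vector"
  assumes "t \<noteq> 0" "\<bar>t\<bar> < 1"
  shows "(norm (x + t *\<^sub>R x) - norm x) / t = norm x"
proof -
  have "x + t *\<^sub>R x = (1 + t) *\<^sub>R x" by (simp add: algebra_simps)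
  then have "norm (x + t *\<^sub>R x) = (1 + t) * norm x" using assms by simp
  then show ?thesis using assms by (simp add: algebra_simps)
qed

lemma g_functional_self: "g_functional x x = (norm x)\<^sup>2"
proof -
  have ev: "\<forall>\<^sub>F t in at 0. (norm (x + t *\<^sub>R x) - norm x) / t = norm x"
    by (auto simp: eventually_at dist_real_def norm_diff_quotient_self intro!: exI[of _ 1])
  have "\<forall>\<^sub>F t in at_right 0. (norm (x + t *\<^sub>R x) - norm x) / t = norm x"
    using ev unfolding eventually_at_split by blast
  then have "((\<lambda>t. (norm (x + t *\<^sub>R x) - norm x) / t) \<longlongrightarrow> norm x) (at_right 0)"
    by (rule tendsto_eventually)
  then have p: "tau_plus x x = norm x"
    unfolding tau_plus_def by (intro tendsto_Lim) auto
  have "\<forall>\<^sub>F t in at_left 0. (norm (x + t *\<^sub>R x) - norm x) / t = norm x"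
    using ev unfolding eventually_at_split by blast
  then have "((\<lambda>t. (norm (x + t *\<^sub>R x) - norm x) / t) \<longlongrightarrow> norm x) (at_left 0)"
    by (rule tendsto_eventually)
  then have m: "tau_minus x x = norm x"
    unfolding tau_minus_def by (intro tendsto_Lim) auto
  show ?thesis by (simp add: g_functional_def p m power2_eq_square)
qed

section \<open>The supremum of determinants\<close>

text \<open>The determinant \<open>D\<close> in expanded form, with the arguments in the order \<open>y\<^sub>1, y\<^sub>2, x\<^sub>1, x\<^sub>2\<close>.\<close>

definition g_det :: "('a \<Rightarrow> 'a \<Rightarrow> real) \<Rightarrow> 'a \<Rightarrow> 'a \<Rightarrow> 'a \<Rightarrow> 'a \<Rightarrow> real" where
  "g_det g y1 y2 x1 x2 = g y1 x1 * g y2 x2 - g y2 x1 * g y1 x2"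

lemma g_two_norm_eq_SUP:
  fixes g :: "'a::real_normed_vector \<Rightarrow> 'a \<Rightarrow> real"
  shows "g_two_norm g x1 x2 = (SUP (y1, y2) \<in> cball 0 1 \<times> cball 0 1. g_det g y1 y2 x1 x2)"
proof -
  have "{(y1, y2). norm y1 \<le> 1 \<and> norm y2 \<le> 1} = cball (0::'a) 1 \<times> cball (0::'a) 1"
    by auto
  then show ?thesis
    unfolding g_two_norm_def by (simp only: g_det_def det_2 vector_2)
qed

text \<open>The argument works for any \<open>g\<close> with the three properties below, wherever it comes from.\<close>

context
  fixes g :: "'a::real_normed_vector \<Rightarrow> 'a \<Rightarrow> real"
  assumes linear_g: "\<And>x. linear (g x)"
    and abs_g_le: "\<And>x y. \<bar>g x y\<bar> \<le> norm x * norm y"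
    and g_self: "\<And>x. g x x = (norm x)\<^sup>2"
begin

lemmas g_linear_simps =
  linear_add[OF linear_g] linear_diff[OF linear_g] linear_scale[OF linear_g]

lemma g_det_le:
  assumes "norm y1 \<le> 1" "norm y2 \<le> 1"
  shows "g_det g y1 y2 x1 x2 \<le> 2 * norm x1 * norm x2"
proof -
  have g: "\<bar>g y x\<bar> \<le> norm x" if "norm y \<le> 1" for y x
    using abs_g_le[of y x] mult_right_mono[OF that norm_ge_zero[of x]] by simp
  have "\<bar>g y1 x1 * g y2 x2\<bar> \<le> norm x1 * norm x2" "\<bar>g y2 x1 * g y1 x2\<bar> \<le> norm x1 * norm x2"
    using assms by (auto simp: abs_mult intro!: mult_mono g)
  then show ?thesis unfolding g_det_def by linarith
qed

lemma g_det_le_g_two_norm: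
  assumes "norm y1 \<le> 1" "norm y2 \<le> 1"
  shows "g_det g y1 y2 x1 x2 \<le> g_two_norm g x1 x2"
proof -
  have "bdd_above ((\<lambda>(y1, y2). g_det g y1 y2 x1 x2) ` (cball 0 1 \<times> cball 0 1))"
    using g_det_le by (intro bdd_aboveI[of _ "2 * norm x1 * norm x2"]) auto
  from cSUP_upper[OF _ this, of "(y1, y2)"] assms show ?thesis
    by (simp add: g_two_norm_eq_SUP)
qed

lemma g_two_norm_le:
  assumes "\<And>y1 y2. norm y1 \<le> 1 \<Longrightarrow> norm y2 \<le> 1 \<Longrightarrow> g_det g y1 y2 x1 x2 \<le> c"
  shows "g_two_norm g x1 x2 \<le> c"
  unfolding g_two_norm_eq_SUP using assms by (intro cSUP_least) auto

lemma abs_g_det_le_g_two_norm: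
  assumes "norm y1 \<le> 1" "norm y2 \<le> 1"
  shows "\<bar>g_det g y1 y2 x1 x2\<bar> \<le> g_two_norm g x1 x2"
proof -
  have "g_det g y2 y1 x1 x2 = - g_det g y1 y2 x1 x2"
    by (simp add: g_det_def)
  then show ?thesis
    using g_det_le_g_two_norm[OF assms, of x1 x2] g_det_le_g_two_norm[OF assms(2,1), of x1 x2] by linarith
qed

lemma g_two_norm_nonneg: "0 \<le> g_two_norm g x1 x2"
  using abs_g_det_le_g_two_norm[of 0 0 x1 x2] by simp

lemma g_two_norm_commute: "g_two_norm g x1 x2 = g_two_norm g x2 x1"
proof -
  have "g_two_norm g x1 x2 \<le> g_two_norm g x2 x1" for x1 x2
  proof (rule g_two_norm_le)
    fix y1 y2 :: 'a
    assume "norm y1 \<le> 1" "norm y2 \<le> 1"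
    then have "g_det g y2 y1 x2 x1 \<le> g_two_norm g x2 x1" by (intro g_det_le_g_two_norm)
    then show "g_det g y1 y2 x1 x2 \<le> g_two_norm g x2 x1" by (simp add: g_det_def mult.commute)
  qed
  then show ?thesis by (intro antisym)
qed

lemma g_det_scale: "g_det g y1 y2 (a *\<^sub>R x1) x2 = a * g_det g y1 y2 x1 x2"
  by (simp add: g_det_def g_linear_simps algebra_simps)

lemma g_two_norm_scale_le: "g_two_norm g (a *\<^sub>R x1) x2 \<le> \<bar>a\<bar> * g_two_norm g x1 x2"
proof (rule g_two_norm_le)
  fix y1 y2 :: 'a
  assume "norm y1 \<le> 1" "norm y2 \<le> 1"
  then have "\<bar>a\<bar> * \<bar>g_det g y1 y2 x1 x2\<bar> \<le> \<bar>a\<bar> * g_two_norm g x1 x2"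
    by (intro mult_left_mono abs_g_det_le_g_two_norm) auto
  then show "g_det g y1 y2 (a *\<^sub>R x1) x2 \<le> \<bar>a\<bar> * g_two_norm g x1 x2"
    using abs_ge_self[of "a * g_det g y1 y2 x1 x2"] by (simp add: g_det_scale abs_mult)
qed

lemma g_two_norm_scale: "g_two_norm g (a *\<^sub>R x1) x2 = \<bar>a\<bar> * g_two_norm g x1 x2"
proof (cases "a = 0")
  case True
  then show ?thesis
    using g_two_norm_scale_le[of a x1 x2] g_two_norm_nonneg[of "a *\<^sub>R x1" x2] by simp
next
  case False
  have "g_two_norm g x1 x2 \<le> \<bar>inverse a\<bar> * g_two_norm g (a *\<^sub>R x1) x2"
    using g_two_norm_scale_le[of "inverse a" "a *\<^sub>R x1" x2] False by simp
  then have "\<bar>a\<bar> * g_two_norm g x1 x2 \<le> g_two_norm g (a *\<^sub>R x1) x2"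
    using False by (simp add: field_simps)
  with g_two_norm_scale_le[of a x1 x2] show ?thesis by simp
qed

lemma g_two_norm_triangle:
  "g_two_norm g x1 (x2 + x3) \<le> g_two_norm g x1 x2 + g_two_norm g x1 x3"
proof (rule g_two_norm_le)
  fix y1 y2 :: 'a
  assume y: "norm y1 \<le> 1" "norm y2 \<le> 1"
  have "g_det g y1 y2 x1 (x2 + x3) = g_det g y1 y2 x1 x2 + g_det g y1 y2 x1 x3"
    by (simp add: g_det_def g_linear_simps algebra_simps)
  then show "g_det g y1 y2 x1 (x2 + x3) \<le> g_two_norm g x1 x2 + g_two_norm g x1 x3"
    using g_det_le_g_two_norm[OF y, of x1 x2] g_det_le_g_two_norm[OF y, of x1 x3] by linarith
qed

lemma g_two_norm_scale_same: "g_two_norm g (a *\<^sub>R x) x = 0"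
proof -
  have "g_two_norm g x x \<le> 0"
    by (rule g_two_norm_le) (simp add: g_det_def mult.commute)
  then show ?thesis
    using g_two_norm_nonneg[of x x] by (simp add: g_two_norm_scale)
qed

lemma g_two_norm_eq_0_if_dependent:
  assumes "lin_dependent_pair x1 x2"
  shows "g_two_norm g x1 x2 = 0"
proof -
  obtain a b where ab: "a \<noteq> 0 \<or> b \<noteq> 0" "a *\<^sub>R x1 + b *\<^sub>R x2 = 0"
    using assms unfolding lin_dependent_pair_def by blast
  show ?thesis
  proof (cases "a = 0")
    case False
    have "a *\<^sub>R x1 = (- b) *\<^sub>R x2"
      using ab(2) by (simp add: eq_neg_iff_add_eq_0)
    then have "\<bar>a\<bar> * g_two_norm g x1 x2 = 0"
      by (metis g_two_norm_scale g_two_norm_scale_same)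
    with False show ?thesis by simp
  next
    case True
    then have "x2 = 0 *\<^sub>R x1" using ab by simp
    then show ?thesis
      by (metis g_two_norm_commute g_two_norm_scale_same)
  qed
qed

section \<open>Positivity on independent pairs\<close>

lemma g_normalized:
  assumes "x \<noteq> 0"
  shows "g (x /\<^sub>R norm x) x = norm x"
proof -
  let ?u = "x /\<^sub>R norm x"
  have "g ?u x = g ?u (norm x *\<^sub>R ?u)" using assms by simp
  also have "\<dots> = norm x * (norm ?u)\<^sup>2" by (simp only: g_linear_simps g_self real_scaleR_def)
  finally show ?thesis using assms by simp
qed

lemma g_two_norm_pos_if_independent:
  assumes "\<not> lin_dependent_pair x1 x2"
  shows "0 < g_two_norm g x1 x2"
proof -
  have x1: "x1 \<noteq> 0"
  proof
    assume "x1 = 0"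
    then have "1 *\<^sub>R x1 + 0 *\<^sub>R x2 = 0" by simp
    then show False using assms unfolding lin_dependent_pair_def by (metis zero_neq_one)
  qed
  define y1 where "y1 = x1 /\<^sub>R norm x1"
  \<comment> \<open>\<open>norm x1\<close> is the value of \<open>g y1 x1\<close>, so this \<open>c\<close> makes \<open>g y1 z\<close> vanish.\<close>
  define c where "c = g y1 x2 / norm x1"
  define z where "z = x2 - c *\<^sub>R x1"
  have z: "z \<noteq> 0"
  proof
    assume "z = 0"
    then have "(- c) *\<^sub>R x1 + 1 *\<^sub>R x2 = 0" by (simp add: z_def)
    then show False using assms unfolding lin_dependent_pair_def by (metis zero_neq_one)
  qed
  define y2 where "y2 = z /\<^sub>R norm z"
  have y1x1: "g y1 x1 = norm x1" using g_normalized[OF x1] by (simp add: y1_def)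
  then have y1z: "g y1 z = 0" using x1 by (simp add: z_def c_def g_linear_simps)
  have "g y2 z = norm z" using g_normalized[OF z] by (simp add: y2_def)
  with y1x1 y1z have "norm x1 * norm z = g_det g y1 y2 x1 z" by (simp add: g_det_def)
  also have "\<dots> = g_det g y1 y2 x1 x2"
    by (simp add: g_det_def z_def g_linear_simps algebra_simps)
  also have "\<dots> \<le> g_two_norm g x1 x2"
    using x1 z by (intro g_det_le_g_two_norm) (simp_all add: y1_def y2_def)
  finally have "norm x1 * norm z \<le> g_two_norm g x1 x2" .
  moreover have "0 < norm x1 * norm z" using x1 z by simp
  ultimately show ?thesis by linarith
qed

lemma two_norm_g_two_norm: "two_norm (g_two_norm g)"
proof -
  have "g_two_norm g x y = 0 \<longleftrightarrow> lin_dependent_pair x y" for x y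
    using g_two_norm_eq_0_if_dependent g_two_norm_pos_if_independent
    by (metis less_irrefl)
  then show ?thesis
    unfolding two_norm_def
    using g_two_norm_commute g_two_norm_scale g_two_norm_triangle by blast
qed

end

theorem proposition2p2:
  fixes g :: "'a::real_normed_vector \<Rightarrow> 'a \<Rightarrow> real"
  assumes "semi_inner_product g"
  shows "two_norm (g_two_norm g)"
proof (rule two_norm_g_two_norm)
  have g: "g = g_functional" and "\<forall>x. linear (g x)"
    using assms unfolding semi_inner_product_def by auto
  then show "linear (g x)" for x by blast
  show "\<bar>g x y\<bar> \<le> norm x * norm y" for x y
    unfolding g by (rule abs_g_functional_le)
  show "g x x = (norm x)\<^sup>2" for x
    unfolding g by (rule g_functional_self)
qed

end
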